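(* Let $\{W_n,\ n\ge 0\}$ be the CUSUM process generated by i.i.d. real random variables $Y_1,Y_2,\ldots$, with partial sums $S_k=Y_1+\dots+Y_k$ and $S_k^+=\max\{S_k,0\}$. For every $n\ge 1$ the mean, variance and moment generating function of $W_n$, whenever they exist, admit the following exact expressions: $$\mathbb{E}W_n=\sum_{k=1}^n\frac1k\,\mathbb{E}S_k^+,$$ $$\mathrm{Var}(W_n)=\sum_{k=1}^n\frac1k\,\mathrm{Var}(S_k^+)+\sum_{k=1}^n\frac1k\,(\mathbb{E}S_k^+)^2-\sum_{\substack{1\le k_1,k_2\le n\\ k_1+k_2>n}}\frac{1}{k_1k_2}\,\mathbb{E}S_{k_1}^+\,\mathbb{E}S_{k_2}^+,$$ $$\mathbb{E}e^{\lambda W_n}=\sum_{\substack{(k_1,\ldots,k_n)\\ \sum_{j=1}^n jk_j=n}}\ \prod_{r=1}^n\frac{\bigl(\mathbb{E}e^{\lambda S_r^+}\bigr)^{k_r}}{r^{k_r}\,k_r!},$$ where in the last formula the sum is over all $n$-tuples $(k_1,\dots,k_n)$ of nonnegative integers with $\sum_{j=1}^n jk_j=n$.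
   Context: The CUSUM process based on $Y_1,Y_2,\ldots$ is defined by $W_0=0$ and $W_{n+1}=\max\{W_n+Y_{n+1},0\}$; equivalently $W_n=S_n-\min_{0\le k\le n}S_k$, where $S_0=0$. "Whenever they exist" means whenever the corresponding expectation, variance, or moment generating function value (at the given real $\lambda$) is finite. *)

theory Defs
  imports "HOL-Probability.Probability"
begin

text \<open>Sequences of random variables are indexed by \<open>nat\<close>, but only the entries
  \<open>Y 1, Y 2, \<dots>\<close> are used.\<close>

primrec cusum :: "(nat \<Rightarrow> 'a \<Rightarrow> real) \<Rightarrow> nat \<Rightarrow> 'a \<Rightarrow> real" where
  "cusum Y 0 \<omega> = 0"
| "cusum Y (Suc n) \<omega> = max (cusum Y n \<omega> + Y (Suc n) \<omega>) 0"

definition psum :: "(nat \<Rightarrow> 'a \<Rightarrow> real) \<Rightarrow> nat \<Rightarrow> 'a \<Rightarrow> real" where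
  "psum Y k \<omega> = (\<Sum>i=1..k. Y i \<omega>)"

definition psum_pos :: "(nat \<Rightarrow> 'a \<Rightarrow> real) \<Rightarrow> nat \<Rightarrow> 'a \<Rightarrow> real" where
  "psum_pos Y k \<omega> = max (psum Y k \<omega>) 0"

definition iid_sequence :: "'a measure \<Rightarrow> (nat \<Rightarrow> 'a \<Rightarrow> real) \<Rightarrow> bool" where
  "iid_sequence M Y \<longleftrightarrow>
     prob_space.indep_vars M (\<lambda>_. borel) Y {1..} \<and>
     (\<forall>i\<ge>1. distr M borel (Y i) = distr M borel (Y 1))"

definition finite_variance :: "'a measure \<Rightarrow> ('a \<Rightarrow> real) \<Rightarrow> bool" where
  "finite_variance M X \<longleftrightarrow>
     integrable M X \<and>
     integrable M (\<lambda>\<omega>. (X \<omega> - prob_space.expectation M X)\<^sup>2)"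

text \<open>An \<open>n\<close>-tuple \<open>(k\<^sub>1, \<dots>, k\<^sub>n)\<close> is an extensional function on \<open>{1..n}\<close>, so that each
  tuple is represented exactly once.\<close>

definition weighted_tuples :: "nat \<Rightarrow> (nat \<Rightarrow> nat) set" where
  "weighted_tuples n = {k \<in> {1..n} \<rightarrow>\<^sub>E UNIV. (\<Sum>j=1..n. j * k j) = n}"

text \<open>Finiteness matters because \<open>sum\<close> over an infinite set is \<open>0\<close>.\<close>

lemma finite_weighted_tuples: "finite (weighted_tuples n)"
proof (rule finite_subset)
  show "weighted_tuples n \<subseteq> {1..n} \<rightarrow>\<^sub>E {..n}"
  proof
    fix k assume k: "k \<in> weighted_tuples n"
    have "k i \<le> n" if "i \<in> {1..n}" for i
    proof -
      have "k i \<le> i * k i" using that by simp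
      also have "\<dots> \<le> (\<Sum>j=1..n. j * k j)"
        using that by (intro member_le_sum) auto
      finally show ?thesis using k by (simp add: weighted_tuples_def)
    qed
    with k show "k \<in> {1..n} \<rightarrow>\<^sub>E {..n}"
      by (auto simp: weighted_tuples_def PiE_def)
  qed
qed (simp add: finite_PiE)

end

theory Submission
  imports Defs
begin

text \<open>
  Write \<open>w\<^sub>n\<close> and \<open>s\<^sub>k\<close> for the laws of \<open>W\<^sub>n\<close> and \<open>S\<^sub>k\<close>, \<open>y\<close> for the law of \<open>Y\<^sub>1\<close>, and \<open>P\<close> for the push-forward
  under \<open>x \<mapsto> max x 0\<close>. Then \<open>w\<^sub>n = P (w\<^sub>n\<^sub>-\<^sub>1 * y)\<close>, and \<open>P\<close> is a Rota--Baxter operator for convolution: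
  \<open>P a * P b + P (a * b) = P (a * P b) + P (P a * b)\<close>. Applied to \<open>a = s\<^sub>k\<close> and \<open>b = w\<^sub>n\<^sub>-\<^sub>k\<^sub>-\<^sub>1 * y\<close> and summed over \<open>k\<close>,
  two of the four terms telescope, which yields by induction Spitzer's recursion
  \<open>n w\<^sub>n = (\<Sum>k=1..n. P s\<^sub>k * w\<^sub>n\<^sub>-\<^sub>k)\<close>. Testing it against \<open>x\<close>, \<open>x\<^sup>2\<close> and \<open>exp (\<lambda> x)\<close> gives scalar recursions whose
  solutions are the three formulas; since all terms are nonnegative, finiteness of the left-hand side also gives
  finiteness of every term on the right.
\<close>

section \<open>The Rota-Baxter identity and Spitzer's recursion\<close>

text \<open>In each of the four sign cases the two arguments of \<open>f\<close> on the left are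
  those on the right, up to order. So nothing beyond commutative addition is asked of the codomain,
  and \<open>ennreal\<close> qualifies.\<close>

lemma max_zero_Rota_Baxter:
  fixes f :: "real \<Rightarrow> 'b :: ab_semigroup_add"
  shows "f (max a 0 + max b 0) + f (max (a + b) 0) = f (max (a + max b 0) 0) + f (max (max a 0 + b) 0)"
  by (cases "a \<ge> 0"; cases "b \<ge> 0") (simp_all add: max_absorb1 max_absorb2 add.commute)

text \<open>Only the one-dimensional laws matter: \<open>S\<close> and \<open>W\<close> sit on one
  space, but the iterated integrals use independent copies of them. Values in \<open>ennreal\<close>
  avoid any integrability condition.\<close>

lemma (in prob_space) Spitzer_recursion:
  fixes S W :: "nat \<Rightarrow> 'a \<Rightarrow> real" and y :: "'a \<Rightarrow> real" and f :: "real \<Rightarrow> ennreal"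
  assumes [measurable]: "\<And>k. S k \<in> borel_measurable M" "\<And>k. W k \<in> borel_measurable M" "y \<in> borel_measurable M"
    and S0: "\<And>\<omega>. S 0 \<omega> = 0" and W0: "\<And>\<omega>. W 0 \<omega> = 0"
    and S_Suc: "\<And>k f. f \<in> borel_measurable borel \<Longrightarrow>
      (\<integral>\<^sup>+\<omega>. f (S (Suc k) \<omega>) \<partial>M) = (\<integral>\<^sup>+\<omega>. \<integral>\<^sup>+\<omega>'. f (S k \<omega> + y \<omega>') \<partial>M \<partial>M)"
    and W_Suc: "\<And>k f. f \<in> borel_measurable borel \<Longrightarrow>
      (\<integral>\<^sup>+\<omega>. f (W (Suc k) \<omega>) \<partial>M) = (\<integral>\<^sup>+\<omega>. \<integral>\<^sup>+\<omega>'. f (max (W k \<omega> + y \<omega>') 0) \<partial>M \<partial>M)"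
    and "f \<in> borel_measurable borel"
  shows "of_nat n * (\<integral>\<^sup>+\<omega>. f (W n \<omega>) \<partial>M) =
    (\<Sum>k=1..n. \<integral>\<^sup>+\<omega>. \<integral>\<^sup>+\<omega>'. f (max (S k \<omega>) 0 + W (n - k) \<omega>') \<partial>M \<partial>M)"
  using \<open>f \<in> borel_measurable borel\<close>
proof (induction n arbitrary: f)
  case 0
  show ?case by simp
next
  case (Suc n)
  note [measurable] = \<open>f \<in> borel_measurable borel\<close>
  interpret pair_sigma_finite M M ..
  \<comment> \<open>For a = s_k and b = w_(n-k) * y, the terms P a * P b, P (a * b), P (a * P b) and
    P (P a * b) give \<open>D k\<close>, \<open>U (Suc k)\<close>, \<open>U k\<close> and
    \<open>V k\<close>: moving \<open>y\<close> from b to a turns s_k into s_(k+1).\<close>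
  define D where "D k = (\<integral>\<^sup>+\<omega>. \<integral>\<^sup>+\<omega>'. f (max (S k \<omega>) 0 + W (Suc n - k) \<omega>') \<partial>M \<partial>M)" for k
  define U where "U k = (\<integral>\<^sup>+\<omega>. \<integral>\<^sup>+\<omega>'. f (max (S k \<omega> + W (Suc n - k) \<omega>') 0) \<partial>M \<partial>M)" for k
  define V where "V k = (\<integral>\<^sup>+\<omega>. \<integral>\<^sup>+\<omega>'. \<integral>\<^sup>+\<omega>''. f (max (max (S k \<omega>) 0 + W (n - k) \<omega>' + y \<omega>'') 0) \<partial>M \<partial>M \<partial>M)" for k
  \<comment> \<open>The identity below is kept free of subtraction, so infinite integrals need no special treatment.\<close>
  have step: "D k + U (Suc k) = U k + V k" if "k \<le> n" for k
  proof -
    define m where "m = n - k"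
    have m: "Suc n - k = Suc m" "Suc n - Suc k = m" "n - k = m"
      using that by (auto simp: m_def)
    have D: "D k = (\<integral>\<^sup>+\<omega>. \<integral>\<^sup>+\<omega>'. \<integral>\<^sup>+\<omega>''. f (max (S k \<omega>) 0 + max (W m \<omega>' + y \<omega>'') 0) \<partial>M \<partial>M \<partial>M)"
      unfolding D_def m by (subst W_Suc) simp_all
    have U: "U k = (\<integral>\<^sup>+\<omega>. \<integral>\<^sup>+\<omega>'. \<integral>\<^sup>+\<omega>''. f (max (S k \<omega> + max (W m \<omega>' + y \<omega>'') 0) 0) \<partial>M \<partial>M \<partial>M)"
      unfolding U_def m by (subst W_Suc) simp_all
    \<comment> \<open>\<open>S_Suc\<close> needs a function of \<open>S (Suc k)\<close> alone, so
      the \<open>W\<close> variable is moved outside and held fixed.\<close>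
    have "U (Suc k) = (\<integral>\<^sup>+\<omega>'. \<integral>\<^sup>+\<omega>. f (max (S (Suc k) \<omega> + W m \<omega>') 0) \<partial>M \<partial>M)"
      unfolding U_def m by (rule Fubini'[symmetric]) measurable
    also have "\<dots> = (\<integral>\<^sup>+\<omega>'. \<integral>\<^sup>+\<omega>. \<integral>\<^sup>+\<omega>''. f (max (S k \<omega> + y \<omega>'' + W m \<omega>') 0) \<partial>M \<partial>M \<partial>M)"
      by (subst S_Suc) simp_all
    also have "\<dots> = (\<integral>\<^sup>+\<omega>. \<integral>\<^sup>+\<omega>'. \<integral>\<^sup>+\<omega>''. f (max (S k \<omega> + y \<omega>'' + W m \<omega>') 0) \<partial>M \<partial>M \<partial>M)"
      by (rule Fubini') measurable
    finally have U': "U (Suc k) = \<dots>" .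
    have "D k + U (Suc k) = (\<integral>\<^sup>+\<omega>. \<integral>\<^sup>+\<omega>'. \<integral>\<^sup>+\<omega>''.
        f (max (S k \<omega>) 0 + max (W m \<omega>' + y \<omega>'') 0) + f (max (S k \<omega> + (W m \<omega>' + y \<omega>'')) 0) \<partial>M \<partial>M \<partial>M)"
      unfolding D U' by (simp add: nn_integral_add ac_simps)
    also have "\<dots> = (\<integral>\<^sup>+\<omega>. \<integral>\<^sup>+\<omega>'. \<integral>\<^sup>+\<omega>''.
        f (max (S k \<omega> + max (W m \<omega>' + y \<omega>'') 0) 0) + f (max (max (S k \<omega>) 0 + (W m \<omega>' + y \<omega>'')) 0) \<partial>M \<partial>M \<partial>M)"
      by (simp only: max_zero_Rota_Baxter)
    also have "\<dots> = U k + V k"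
      unfolding U V_def m by (simp add: nn_integral_add ac_simps)
    finally show ?thesis .
  qed
  \<comment> \<open>The boundary terms stand on opposite sides because \<open>ennreal\<close> has no
    cancellation at infinity.\<close>
  have telescope: "(\<Sum>k=1..j. D k) + U (Suc j) = U 1 + (\<Sum>k=1..j. V k)" if "j \<le> n" for j
    using that
  proof (induction j)
    case (Suc j)
    then have "(\<Sum>k=1..Suc j. D k) + U (Suc (Suc j)) = (\<Sum>k=1..j. D k) + (D (Suc j) + U (Suc (Suc j)))"
      by (simp add: add.assoc)
    also have "\<dots> = ((\<Sum>k=1..j. D k) + U (Suc j)) + V (Suc j)"
      using Suc.prems by (simp only: step add.assoc)
    also have "\<dots> = U 1 + (\<Sum>k=1..Suc j. V k)"
      using Suc by (simp add: add.assoc)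
    finally show ?case .
  qed simp
  \<comment> \<open>The induction hypothesis is applied to \<open>g\<close>, which absorbs the last
    step of the walk; hence \<open>f\<close> has to be arbitrary in the induction.\<close>
  define g where "g x = (\<integral>\<^sup>+\<omega>''. f (max (x + y \<omega>'') 0) \<partial>M)" for x
  have [measurable]: "g \<in> borel_measurable borel"
    unfolding g_def by measurable
  have V: "(\<Sum>k=1..n. V k) = of_nat n * (\<integral>\<^sup>+\<omega>. f (W (Suc n) \<omega>) \<partial>M)"
    using Suc.IH[of g] by (simp add: V_def g_def W_Suc)
  \<comment> \<open>As s_1 = y, the term \<open>U 1\<close> tests P (y * w_n) = w_(n+1). It raises
    the factor from \<open>n\<close> to \<open>Suc n\<close>, while the other boundary term supplies
    the missing summand \<open>D (Suc n)\<close>.\<close>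
  have "U 1 = (\<integral>\<^sup>+\<omega>'. \<integral>\<^sup>+\<omega>. f (max (S (Suc 0) \<omega> + W n \<omega>') 0) \<partial>M \<partial>M)"
    unfolding U_def by (subst Fubini') (simp_all)
  also have "\<dots> = (\<integral>\<^sup>+\<omega>. f (W (Suc n) \<omega>) \<partial>M)"
    by (subst S_Suc) (simp_all add: S0 W_Suc emeasure_space_1 add.commute)
  finally have U1: "U 1 = \<dots>" .
  have "U (Suc n) = D (Suc n)"
    by (simp add: U_def D_def W0)
  then have "(\<Sum>k=1..Suc n. D k) = of_nat (Suc n) * (\<integral>\<^sup>+\<omega>. f (W (Suc n) \<omega>) \<partial>M)"
    using telescope[of n] by (simp add: U1[simplified] V[simplified] algebra_simps)
  then show ?case by (simp add: D_def)
qed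

section \<open>From independence to iterated integrals\<close>

text \<open>The joint law is a product, so Tonelli applies. The law of \<open>Y\<close> is not
  pulled back to \<open>M\<close>, so that an equal law can be substituted for it.\<close>

lemma (in prob_space) nn_integral_indep_pair:
  assumes "indep_var S X T Y" and f: "case_prod f \<in> borel_measurable (S \<Otimes>\<^sub>M T)"
  shows "(\<integral>\<^sup>+\<omega>. f (X \<omega>) (Y \<omega>) \<partial>M) = (\<integral>\<^sup>+\<omega>. \<integral>\<^sup>+y. f (X \<omega>) y \<partial>distr M T Y \<partial>M)"
proof -
  have [measurable]: "X \<in> measurable M S" "Y \<in> measurable M T"
    and prod: "distr M S X \<Otimes>\<^sub>M distr M T Y = distr M (S \<Otimes>\<^sub>M T) (\<lambda>x. (X x, Y x))"
    using assms(1) by (auto simp: indep_var_distribution_eq)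
  note [measurable] = f
  interpret Y: prob_space "distr M T Y" by (rule prob_space_distr) measurable
  have "(\<integral>\<^sup>+\<omega>. f (X \<omega>) (Y \<omega>) \<partial>M) = (\<integral>\<^sup>+p. case_prod f p \<partial>distr M (S \<Otimes>\<^sub>M T) (\<lambda>x. (X x, Y x)))"
    by (subst nn_integral_distr) simp_all
  also have "\<dots> = (\<integral>\<^sup>+x. \<integral>\<^sup>+y. f x y \<partial>distr M T Y \<partial>distr M S X)"
    unfolding prod[symmetric] by (subst Y.nn_integral_fst[symmetric]) simp_all
  also have "\<dots> = (\<integral>\<^sup>+\<omega>. \<integral>\<^sup>+y. f (X \<omega>) y \<partial>distr M T Y \<partial>M)"
  proof (rule nn_integral_distr)
    show "(\<lambda>x. \<integral>\<^sup>+y. f x y \<partial>distr M T Y) \<in> borel_measurable (distr M S X)"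
      by (rule Y.borel_measurable_nn_integral) simp
  qed measurable
  finally show ?thesis .
qed

text \<open>Replaces the next increment by an independent copy of \<open>Y 1\<close>. The past
  enters through a function \<open>h\<close> of the tuple of the first \<open>n\<close> variables,
  since disjoint blocks of an independent family are independent.\<close>

lemma (in prob_space) nn_integral_indep_next:
  fixes Y :: "nat \<Rightarrow> 'a \<Rightarrow> real" and h :: "(nat \<Rightarrow> real) \<Rightarrow> real"
  assumes indep: "indep_vars (\<lambda>_. borel) Y {1..}"
    and dist: "distr M borel (Y (Suc n)) = distr M borel (Y 1)"
    and h: "h \<in> borel_measurable (Pi\<^sub>M {1..n} (\<lambda>_. borel))"
    and f: "case_prod f \<in> borel_measurable (borel \<Otimes>\<^sub>M borel)"
  shows "(\<integral>\<^sup>+\<omega>. f (h (\<lambda>i\<in>{1..n}. Y i \<omega>)) (Y (Suc n) \<omega>) \<partial>M) =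
    (\<integral>\<^sup>+\<omega>. \<integral>\<^sup>+\<omega>'. f (h (\<lambda>i\<in>{1..n}. Y i \<omega>)) (Y 1 \<omega>') \<partial>M \<partial>M)"
proof -
  have "indep_var borel (h \<circ> (\<lambda>\<omega>. \<lambda>i\<in>{1..n}. Y i \<omega>)) borel ((\<lambda>g. g (Suc n)) \<circ> (\<lambda>\<omega>. \<lambda>i\<in>{Suc n}. Y i \<omega>))"
    by (rule indep_var_compose[OF indep_var_restrict[OF indep] h]) auto
  moreover have "(\<lambda>g. g (Suc n)) \<circ> (\<lambda>\<omega>. \<lambda>i\<in>{Suc n}. Y i \<omega>) = Y (Suc n)"
    by auto
  ultimately have iv: "indep_var borel (\<lambda>\<omega>. h (\<lambda>i\<in>{1..n}. Y i \<omega>)) borel (Y (Suc n))"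
    by (simp add: comp_def)
  have Y1: "Y 1 \<in> borel_measurable M"
    using indep by (auto simp: indep_vars_def)
  note [measurable] = f
  show ?thesis
    by (subst nn_integral_indep_pair[OF iv f], subst dist, intro nn_integral_cong nn_integral_distr)
      (use Y1 in auto)
qed

lemma cusum_0: "cusum Y 0 = (\<lambda>_. 0)"
  by auto

text \<open>The two sample points may lie in different spaces, which allows a comparison with the
  coordinate process on tuples.\<close>

lemma cusum_cong:
  "(\<And>i. i \<in> {1..n} \<Longrightarrow> X i \<omega> = Y i \<omega>') \<Longrightarrow> cusum X n \<omega> = cusum Y n \<omega>'"
  by (induction n) auto

lemma borel_measurable_cusum:
  "(\<And>i. i \<in> {1..n} \<Longrightarrow> Y i \<in> borel_measurable M) \<Longrightarrow> cusum Y n \<in> borel_measurable M"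
proof (induction n)
  case 0
  show ?case by (simp add: cusum_0)
next
  case (Suc n)
  have [measurable]: "cusum Y n \<in> borel_measurable M" "Y (Suc n) \<in> borel_measurable M"
    using Suc by auto
  have "cusum Y (Suc n) = (\<lambda>\<omega>. max (cusum Y n \<omega> + Y (Suc n) \<omega>) 0)" by auto
  then show ?case by simp
qed

lemma borel_measurable_psum:
  "(\<And>i. i \<in> {1..n} \<Longrightarrow> Y i \<in> borel_measurable M) \<Longrightarrow> psum Y n \<in> borel_measurable M"
  unfolding psum_def[abs_def] by measurable

lemma psum_pos_nonneg: "0 \<le> psum_pos Y k \<omega>"
  by (simp add: psum_pos_def)

lemma cusum_nonneg: "0 \<le> cusum Y n \<omega>"
  by (cases n) auto

context prob_space
begin

context
  fixes Y :: "nat \<Rightarrow> 'a \<Rightarrow> real"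
  assumes iid: "iid_sequence M Y"
begin

lemma iid_indep_vars: "indep_vars (\<lambda>_. borel) Y {1..}"
  using iid unfolding iid_sequence_def by blast

lemma iid_distr: "distr M borel (Y (Suc n)) = distr M borel (Y 1)"
  using iid unfolding iid_sequence_def by (metis le_add1 plus_1_eq_Suc)

lemma borel_measurable_iid: "i \<ge> 1 \<Longrightarrow> Y i \<in> borel_measurable M"
  using iid_indep_vars by (auto simp: indep_vars_def)

lemma nn_integral_cusum_Suc:
  assumes [measurable]: "f \<in> borel_measurable borel"
  shows "(\<integral>\<^sup>+\<omega>. f (cusum Y (Suc n) \<omega>) \<partial>M) =
    (\<integral>\<^sup>+\<omega>. \<integral>\<^sup>+\<omega>'. f (max (cusum Y n \<omega> + Y 1 \<omega>') 0) \<partial>M \<partial>M)"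
proof -
  \<comment> \<open>Running the recursion on the coordinate process exhibits
    \<open>cusum Y n\<close> as a fixed function of the first \<open>n\<close> increments.\<close>
  have eq: "cusum Y n \<omega> = cusum (\<lambda>i g. g i) n (\<lambda>i\<in>{1..n}. Y i \<omega>)" for \<omega>
    by (rule cusum_cong) auto
  have "cusum (\<lambda>i g. g i) n \<in> borel_measurable (Pi\<^sub>M {1..n} (\<lambda>_. borel))"
    by (rule borel_measurable_cusum) simp
  from nn_integral_indep_next[OF iid_indep_vars iid_distr this, where f = "\<lambda>x y. f (max (x + y) 0)"] show ?thesis
    by (simp add: eq[symmetric] del: One_nat_def)
qed

lemma nn_integral_psum_Suc:
  assumes [measurable]: "f \<in> borel_measurable borel"
  shows "(\<integral>\<^sup>+\<omega>. f (psum Y (Suc n) \<omega>) \<partial>M) =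
    (\<integral>\<^sup>+\<omega>. \<integral>\<^sup>+\<omega>'. f (psum Y n \<omega> + Y 1 \<omega>') \<partial>M \<partial>M)"
proof -
  have eq: "psum Y n \<omega> = psum (\<lambda>i g. g i) n (\<lambda>i\<in>{1..n}. Y i \<omega>)" for \<omega>
    unfolding psum_def by (rule sum.cong) auto
  have Suc: "psum Y (Suc n) \<omega> = psum Y n \<omega> + Y (Suc n) \<omega>" for \<omega>
    by (simp add: psum_def)
  have "psum (\<lambda>i g. g i) n \<in> borel_measurable (Pi\<^sub>M {1..n} (\<lambda>_. borel))"
    by (rule borel_measurable_psum) simp
  from nn_integral_indep_next[OF iid_indep_vars iid_distr this, where f = "\<lambda>x y. f (x + y)"] show ?thesis
    by (simp add: eq[symmetric] Suc del: One_nat_def)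
qed

end
end

section \<open>Solving the recursion for the moment generating function\<close>

text \<open>The length \<open>N\<close> of the tuples is decoupled from the weight \<open>m\<close>, so that the recursion in \<open>m\<close> stays
  within tuples of one length.\<close>

definition cycle_index :: "nat \<Rightarrow> (nat \<Rightarrow> real) \<Rightarrow> nat \<Rightarrow> real" where
  "cycle_index N a m = (\<Sum>k\<in>{k \<in> {1..N} \<rightarrow>\<^sub>E UNIV. (\<Sum>j=1..N. j * k j) = m}.
     \<Prod>r=1..N. a r ^ k r / (real r ^ k r * fact (k r)))"

lemma finite_tuples: "finite {k \<in> {1..N} \<rightarrow>\<^sub>E (UNIV :: nat set). (\<Sum>j=1..N. j * k j) = m}"
proof (rule finite_subset)
  have "k i \<le> (\<Sum>j=1..N. j * k j)" if "i \<in> {1..N}" for i k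
  proof -
    have "k i \<le> i * k i" using that by simp
    also have "\<dots> \<le> (\<Sum>j=1..N. j * k j)"
      using that by (intro member_le_sum) auto
    finally show ?thesis .
  qed
  then show "{k \<in> {1..N} \<rightarrow>\<^sub>E (UNIV :: nat set). (\<Sum>j=1..N. j * k j) = m} \<subseteq> {1..N} \<rightarrow>\<^sub>E {..m}"
    by (auto simp: PiE_def)
qed (simp add: finite_PiE)

lemma cycle_index_0: "cycle_index N a 0 = 1"
proof -
  have "{k \<in> {1..N} \<rightarrow>\<^sub>E UNIV. (\<Sum>j=1..N. j * k j) = 0} = {\<lambda>i\<in>{1..N}. 0}"
    by (auto simp: PiE_def extensional_def fun_eq_iff)
  then show ?thesis by (simp add: cycle_index_def)
qed

text \<open>\<open>cycle_index N a m\<close> is the coefficient of x^m in exp (sum over r = 1..N of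
  a_r x^r / r), and the recursion is what differentiating this series gives. The proof instead
  splits the weight \<open>m\<close> of a tuple into its parts \<open>j * k j\<close>.\<close>

lemma cycle_index_rec:
  assumes "m \<le> N"
  shows "real m * cycle_index N a m = (\<Sum>j=1..m. a j * cycle_index N a (m - j))"
proof -
  define T where "T m = {k \<in> {1..N} \<rightarrow>\<^sub>E (UNIV :: nat set). (\<Sum>j=1..N. j * k j) = m}" for m
  define w where "w k r = a r ^ k r / (real r ^ k r * fact (k r))" for k :: "nat \<Rightarrow> nat" and r
  have fin: "finite (T m)" for m
    unfolding T_def by (rule finite_tuples)
  have CI: "cycle_index N a m = (\<Sum>k\<in>T m. \<Prod>r=1..N. w k r)" for m
    by (simp add: cycle_index_def T_def w_def)
  \<comment> \<open>Lowering \<open>k j\<close> by one maps the tuples of weight \<open>m\<close>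
    with \<open>k j > 0\<close> bijectively onto those of weight \<open>m - j\<close>; the factor
    \<open>j * k j\<close> cancels against the denominator and leaves one
    \<open>a j\<close>.\<close>
  have shift: "(\<Sum>k\<in>T m. real (j * k j) * (\<Prod>r=1..N. w k r)) =
      (if j \<le> m then a j * cycle_index N a (m - j) else 0)" if j: "j \<in> {1..N}" for j
  proof -
    have sum_upd: "(\<Sum>i=1..N. i * (k(j := v)) i) = j * v + (\<Sum>i\<in>{1..N} - {j}. i * k i)" for k v
      by (subst sum.remove[OF _ j]) (auto intro!: sum.cong)
    have prod_upd: "(\<Prod>i=1..N. w (k(j := v)) i) = w (\<lambda>_. v) j * (\<Prod>i\<in>{1..N} - {j}. w k i)" for k v
      by (subst prod.remove[OF _ j]) (auto simp: w_def intro!: prod.cong)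
    note split_sum = sum_upd[of k "k j" for k, unfolded fun_upd_triv]
    note split_prod = prod_upd[of k "k j" for k, unfolded fun_upd_triv]
    have "(\<Sum>k\<in>T m. real (j * k j) * (\<Prod>r=1..N. w k r)) =
        (\<Sum>k\<in>{k\<in>T m. k j > 0}. real (j * k j) * (\<Prod>r=1..N. w k r))"
      using fin by (intro sum.mono_neutral_right) auto
    also have "\<dots> = (if j \<le> m then a j * cycle_index N a (m - j) else 0)"
    proof (cases "j \<le> m")
      case True
      have "(\<Sum>k\<in>{k\<in>T m. k j > 0}. real (j * k j) * (\<Prod>r=1..N. w k r)) =
          (\<Sum>k\<in>T (m - j). a j * (\<Prod>r=1..N. w k r))"
      proof (rule sum.reindex_bij_witness[where j = "\<lambda>k. k(j := k j - 1)" and i = "\<lambda>k. k(j := Suc (k j))"])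
        fix k assume k: "k \<in> {k\<in>T m. k j > 0}"
        then obtain l where l: "k j = Suc l" by (auto simp: gr0_conv_Suc)
        show "(k(j := k j - 1))(j := Suc ((k(j := k j - 1)) j)) = k"
          using l by auto
        have "(\<Sum>i=1..N. i * (k(j := k j - 1)) i) = m - j"
          using k split_sum[of k] unfolding sum_upd by (simp add: T_def l)
        then show "k(j := k j - 1) \<in> T (m - j)"
          using k j by (auto simp: T_def PiE_def extensional_def)
        have "real (j * k j) * w (\<lambda>_. k j) j = a j * w (\<lambda>_. k j - 1) j"
          using j by (simp add: w_def l divide_simps) (simp add: algebra_simps)
        then show "a j * (\<Prod>r=1..N. w (k(j := k j - 1)) r) = real (j * k j) * (\<Prod>r=1..N. w k r)"
          unfolding prod_upd split_prod[of k] by (simp only: mult.assoc[symmetric])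
      next
        fix k assume k: "k \<in> T (m - j)"
        show "(k(j := Suc (k j)))(j := (k(j := Suc (k j))) j - 1) = k" by auto
        have "(\<Sum>i=1..N. i * (k(j := Suc (k j))) i) = m"
          using k True split_sum[of k] unfolding sum_upd by (simp add: T_def)
        then show "k(j := Suc (k j)) \<in> {k\<in>T m. k j > 0}"
          using k j by (auto simp: T_def PiE_def extensional_def)
      qed
      then show ?thesis using True by (simp add: CI sum_distrib_left)
    next
      case False
      then have "{k\<in>T m. k j > 0} = {}"
        using split_sum by (auto simp: T_def gr0_conv_Suc)
      then show ?thesis using False by (simp only: if_False sum.empty)
    qed
    finally show ?thesis .
  qed
  have "real m * cycle_index N a m = (\<Sum>k\<in>T m. (\<Sum>j=1..N. real (j * k j)) * (\<Prod>r=1..N. w k r))"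
    unfolding CI sum_distrib_left by (rule sum.cong) (auto simp: T_def)
  also have "\<dots> = (\<Sum>j=1..N. \<Sum>k\<in>T m. real (j * k j) * (\<Prod>r=1..N. w k r))"
    unfolding sum_distrib_right by (rule sum.swap)
  also have "\<dots> = (\<Sum>j=1..N. if j \<le> m then a j * cycle_index N a (m - j) else 0)"
    using shift by (intro sum.cong) auto
  \<comment> \<open>Here \<open>m \<le> N\<close> ensures that every \<open>j \<le> m\<close> is an
    available part size.\<close>
  also have "\<dots> = (\<Sum>j=1..m. a j * cycle_index N a (m - j))"
    using assms by (intro sum.mono_neutral_cong_right) auto
  finally show ?thesis .
qed

section \<open>Solving the recursions for the first two moments\<close>

lemma sum_diff_reverse:
  fixes g :: "nat \<Rightarrow> 'b :: comm_monoid_add"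
  shows "(\<Sum>k=1..m. g (m - k)) = (\<Sum>i<m. g i)"
  by (rule sum.reindex_bij_witness[where i = "\<lambda>i. m - i" and j = "\<lambda>k. m - k"]) auto

text \<open>Subtracting consecutive recursions removes the sum over the past and leaves (m+1)
  (\<mu>_(m+1) - \<mu>_m) = p_(m+1).\<close>

lemma first_moment_recursion_solution:
  fixes \<mu> p :: "nat \<Rightarrow> real"
  assumes rec: "\<And>m. m \<le> n \<Longrightarrow> real m * \<mu> m = (\<Sum>k=1..m. p k + \<mu> (m - k))"
    and "\<mu> 0 = 0" "m \<le> n"
  shows "\<mu> m = (\<Sum>k=1..m. p k / real k)"
  using \<open>m \<le> n\<close>
proof (induction m)
  case 0
  show ?case using \<open>\<mu> 0 = 0\<close> by simp
next
  case (Suc m)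
  have "real m * \<mu> m = (\<Sum>k=1..m. p k) + (\<Sum>i<m. \<mu> i)"
    using rec[of m] Suc.prems by (simp only: sum.distrib sum_diff_reverse)
  moreover have "real (Suc m) * \<mu> (Suc m) = (\<Sum>k=1..Suc m. p k) + (\<Sum>i<Suc m. \<mu> i)"
    using rec[of "Suc m"] Suc.prems by (simp only: sum.distrib sum_diff_reverse)
  ultimately have "real (Suc m) * \<mu> (Suc m) = real (Suc m) * \<mu> m + p (Suc m)"
    by (simp add: algebra_simps)
  then have "\<mu> (Suc m) = \<mu> m + p (Suc m) / real (Suc m)"
    by (simp add: field_simps del: of_nat_Suc)
  then show ?case using Suc by simp
qed

text \<open>Under the reflection \<open>k \<mapsto> Suc m - k\<close> the weight \<open>k\<close>
  averages to half of \<open>Suc m\<close>.\<close>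

lemma sum_diff_weighted_convolution:
  fixes d :: "nat \<Rightarrow> real"
  shows "2 * (\<Sum>k=1..m. real k * d k * d (Suc m - k)) = real (Suc m) * (\<Sum>k=1..m. d k * d (Suc m - k))"
proof -
  have "(\<Sum>k=1..m. real k * d k * d (Suc m - k)) = (\<Sum>k=1..m. real (Suc m - k) * d k * d (Suc m - k))"
    by (rule sum.reindex_bij_witness[where i = "\<lambda>k. Suc m - k" and j = "\<lambda>k. Suc m - k"]) auto
  then have "2 * (\<Sum>k=1..m. real k * d k * d (Suc m - k)) =
      (\<Sum>k=1..m. real k * d k * d (Suc m - k)) + (\<Sum>k=1..m. real (Suc m - k) * d k * d (Suc m - k))"
    by simp
  also have "\<dots> = (\<Sum>k=1..m. real (Suc m) * (d k * d (Suc m - k)))"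
    unfolding sum.distrib[symmetric]
    by (rule sum.cong) (auto simp: of_nat_diff algebra_simps)
  finally show ?thesis by (simp add: sum_distrib_left)
qed

text \<open>Consecutive recursions are subtracted again. The cross terms differ by twice the sum of
  k d_k d_(m+1-k), which symmetrization turns into \<open>Suc m\<close> times a convolution, so
  \<open>Suc m\<close> cancels.\<close>

lemma second_moment_recursion_solution:
  fixes \<mu> p q r :: "nat \<Rightarrow> real"
  assumes rec1: "\<And>m. m \<le> n \<Longrightarrow> real m * \<mu> m = (\<Sum>k=1..m. p k + \<mu> (m - k))" and "\<mu> 0 = 0"
    and rec2: "\<And>m. m \<le> n \<Longrightarrow> real m * q m = (\<Sum>k=1..m. r k + 2 * p k * \<mu> (m - k) + q (m - k))" and "q 0 = 0"
    and "m \<le> n"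
  defines "d \<equiv> \<lambda>k. p k / real k"
  shows "q m = (\<Sum>k=1..m. r k / real k) + (\<Sum>s=1..m. \<Sum>k=1..s-1. d k * d (s - k))"
  using \<open>m \<le> n\<close>
proof (induction m)
  case 0
  show ?case using \<open>q 0 = 0\<close> by simp
next
  case (Suc m)
  have \<mu>: "\<mu> j = (\<Sum>k=1..j. d k)" if "j \<le> n" for j
    unfolding d_def using first_moment_recursion_solution[OF rec1 \<open>\<mu> 0 = 0\<close> that] by simp
  have "real m * q m = (\<Sum>k=1..m. r k) + (\<Sum>k=1..m. 2 * p k * \<mu> (m - k)) + (\<Sum>i<m. q i)"
    using rec2[of m] Suc.prems by (simp only: sum.distrib sum_diff_reverse)
  moreover have "real (Suc m) * q (Suc m) =
      (\<Sum>k=1..Suc m. r k) + (\<Sum>k=1..Suc m. 2 * p k * \<mu> (Suc m - k)) + (\<Sum>i<Suc m. q i)"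
    using rec2[of "Suc m"] Suc.prems by (simp only: sum.distrib sum_diff_reverse)
  \<comment> \<open>The summand at \<open>k = Suc m\<close> vanishes because
    \<open>\<mu> 0 = 0\<close>.\<close>
  moreover have "(\<Sum>k=1..Suc m. 2 * p k * \<mu> (Suc m - k)) =
      (\<Sum>k=1..m. 2 * p k * \<mu> (m - k)) + 2 * (\<Sum>k=1..m. real k * d k * d (Suc m - k))"
  proof -
    have "2 * p k * \<mu> (Suc m - k) = 2 * p k * \<mu> (m - k) + 2 * (real k * d k * d (Suc m - k))"
      if "k \<in> {1..m}" for k
    proof -
      have "\<mu> (Suc m - k) = \<mu> (m - k) + d (Suc m - k)"
        using that Suc.prems by (simp add: \<mu> Suc_diff_le)
      moreover have "p k = real k * d k"
        using that by (simp add: d_def)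
      ultimately show ?thesis by (simp add: algebra_simps)
    qed
    then have "(\<Sum>k=1..m. 2 * p k * \<mu> (Suc m - k)) =
        (\<Sum>k=1..m. 2 * p k * \<mu> (m - k) + 2 * (real k * d k * d (Suc m - k)))"
      by (rule sum.cong[OF refl])
    then show ?thesis
      by (simp add: \<open>\<mu> 0 = 0\<close> sum.distrib sum_distrib_left)
  qed
  ultimately have "real (Suc m) * q (Suc m) =
      real (Suc m) * q m + r (Suc m) + real (Suc m) * (\<Sum>k=1..m. d k * d (Suc m - k))"
    unfolding sum_diff_weighted_convolution by (simp add: algebra_simps)
  then have "q (Suc m) = q m + r (Suc m) / real (Suc m) + (\<Sum>k=1..m. d k * d (Suc m - k))"
    by (simp add: field_simps del: of_nat_Suc)
  then show ?case using Suc by simp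
qed

text \<open>The square sums over all pairs; those with i + j = s \<le> n make up the convolution at
  \<open>s\<close>, and the others remain.\<close>

lemma square_sum_minus_convolutions:
  fixes d :: "nat \<Rightarrow> real"
  shows "(\<Sum>k=1..n. d k)\<^sup>2 - (\<Sum>s=1..n. \<Sum>k=1..s-1. d k * d (s - k)) =
    (\<Sum>(i, j)\<in>{(i, j). i \<in> {1..n} \<and> j \<in> {1..n} \<and> i + j > n}. d i * d j)"
proof -
  let ?A = "{(i, j). i \<in> {1..n} \<and> j \<in> {1..n} \<and> i + j > n}"
  let ?B = "{(i, j). i \<in> {1..n} \<and> j \<in> {1..n} \<and> i + j \<le> n}"
  have un: "{1..n} \<times> {1..n} = ?A \<union> ?B" by auto
  have fin: "finite ?A" "finite ?B"
    by (rule finite_subset[of _ "{1..n} \<times> {1..n}"]; auto)+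
  have "(\<Sum>k=1..n. d k)\<^sup>2 = (\<Sum>(i, j)\<in>{1..n} \<times> {1..n}. d i * d j)"
    by (simp add: power2_eq_square sum_product sum.cartesian_product)
  also have "\<dots> = (\<Sum>(i, j)\<in>?A. d i * d j) + (\<Sum>(i, j)\<in>?B. d i * d j)"
    unfolding un by (rule sum.union_disjoint[OF fin]) auto
  also have "(\<Sum>(i, j)\<in>?B. d i * d j) = (\<Sum>(s, k)\<in>(SIGMA s:{1..n}. {1..s-1}). d k * d (s - k))"
    by (rule sum.reindex_bij_witness[where i = "\<lambda>(s, k). (k, s - k)" and j = "\<lambda>(i, j). (i + j, i)"]) auto
  also have "\<dots> = (\<Sum>s=1..n. \<Sum>k=1..s-1. d k * d (s - k))"
    by (simp add: sum.Sigma)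
  finally show ?thesis by simp
qed

section \<open>Real-valued recursions and finiteness of their terms\<close>

context prob_space
begin

text \<open>Passing to raw second moments allows one test function, the square, for all variables in
  the recursion.\<close>

lemma finite_variance_iff_square_integrable:
  assumes [measurable]: "X \<in> borel_measurable M"
  shows "finite_variance M X \<longleftrightarrow> integrable M X \<and> integrable M (\<lambda>\<omega>. (X \<omega>)\<^sup>2)"
proof -
  have "integrable M (\<lambda>\<omega>. (X \<omega> - c)\<^sup>2) \<longleftrightarrow> integrable M (\<lambda>\<omega>. (X \<omega>)\<^sup>2)" if X: "integrable M X" for c
  proof
    assume "integrable M (\<lambda>\<omega>. (X \<omega> - c)\<^sup>2)"
    then have "integrable M (\<lambda>\<omega>. (X \<omega> - c)\<^sup>2 + 2 * c * X \<omega> - c\<^sup>2)"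
      using X by auto
    then show "integrable M (\<lambda>\<omega>. (X \<omega>)\<^sup>2)" by (simp add: power2_diff algebra_simps)
  next
    assume "integrable M (\<lambda>\<omega>. (X \<omega>)\<^sup>2)"
    then have "integrable M (\<lambda>\<omega>. (X \<omega>)\<^sup>2 - 2 * c * X \<omega> + c\<^sup>2)"
      using X by auto
    then show "integrable M (\<lambda>\<omega>. (X \<omega> - c)\<^sup>2)" by (simp add: power2_diff algebra_simps)
  qed
  then show ?thesis unfolding finite_variance_def by blast
qed

text \<open>Signs matter: for nonnegative \<open>X\<close> and \<open>c\<close> the square of
  \<open>X\<close> is dominated by that of \<open>X + c\<close>.\<close>

lemma square_integrable_if_shift_square_integrable:
  fixes X :: "'a \<Rightarrow> real"
  assumes [measurable]: "X \<in> borel_measurable M"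
    and "\<And>\<omega>. 0 \<le> X \<omega>" "0 \<le> c" and int: "integrable M (\<lambda>\<omega>. (X \<omega> + c)\<^sup>2)"
  shows "integrable M (\<lambda>\<omega>. (X \<omega>)\<^sup>2)"
  by (rule Bochner_Integration.integrable_bound[OF int]) (use assms in \<open>auto intro!: power_mono\<close>)

context
  fixes Y :: "nat \<Rightarrow> 'a \<Rightarrow> real"
  assumes iid: "iid_sequence M Y"
begin

lemma borel_measurable_cusum_iid [measurable]: "cusum Y n \<in> borel_measurable M"
  by (rule borel_measurable_cusum) (simp add: borel_measurable_iid[OF iid])

lemma borel_measurable_psum_iid [measurable]: "psum Y n \<in> borel_measurable M"
  by (rule borel_measurable_psum) (simp add: borel_measurable_iid[OF iid])

lemma borel_measurable_psum_pos_iid [measurable]: "psum_pos Y n \<in> borel_measurable M"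
  unfolding psum_pos_def[abs_def] by measurable

text \<open>The last two claims pass finiteness on to each summand separately, up to a constant
  shift \<open>c\<close>, which is a value of the other summand.\<close>

lemma cusum_Spitzer:
  assumes f[measurable]: "f \<in> borel_measurable borel" and nonneg: "\<And>x. 0 \<le> x \<Longrightarrow> 0 \<le> f x"
    and int: "integrable M (\<lambda>\<omega>. f (cusum Y n \<omega>))"
  shows "real n * (\<integral>\<omega>. f (cusum Y n \<omega>) \<partial>M) =
      (\<Sum>k=1..n. \<integral>\<omega>. \<integral>\<omega>'. f (psum_pos Y k \<omega> + cusum Y (n - k) \<omega>') \<partial>M \<partial>M)" (is ?eq)
    and "k \<in> {1..n} \<Longrightarrow> \<exists>c\<ge>0. integrable M (\<lambda>\<omega>. f (psum_pos Y k \<omega> + c))" (is "_ \<Longrightarrow> ?S")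
    and "k \<in> {1..n} \<Longrightarrow> \<exists>c\<ge>0. integrable M (\<lambda>\<omega>. f (cusum Y (n - k) \<omega> + c))" (is "_ \<Longrightarrow> ?W")
proof -
  interpret P: pair_sigma_finite M M ..
  define F where "F k = (\<lambda>(\<omega>, \<omega>'). f (psum_pos Y k \<omega> + cusum Y (n - k) \<omega>'))" for k
  have [measurable]: "F k \<in> borel_measurable (M \<Otimes>\<^sub>M M)" for k
    unfolding F_def by measurable
  have F_nonneg: "0 \<le> F k z" for k z
    by (auto simp: F_def psum_pos_nonneg cusum_nonneg intro!: nonneg split: prod.split)
  have Y1: "Y 1 \<in> borel_measurable M" by (rule borel_measurable_iid[OF iid]) simp
  have cusum0: "cusum Y 0 \<omega> = 0" for \<omega> by simp
  have psum0: "psum Y 0 \<omega> = 0" for \<omega> by (simp add: psum_def)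
  have iterated: "(\<integral>\<^sup>+\<omega>. \<integral>\<^sup>+\<omega>'. ennreal (F k (\<omega>, \<omega>')) \<partial>M \<partial>M) = (\<integral>\<^sup>+z. ennreal (F k z) \<partial>(M \<Otimes>\<^sub>M M))" for k
    by (rule nn_integral_fst) measurable
  have "of_nat n * (\<integral>\<^sup>+\<omega>. ennreal (f (cusum Y n \<omega>)) \<partial>M) =
      (\<Sum>k=1..n. \<integral>\<^sup>+\<omega>. \<integral>\<^sup>+\<omega>'. ennreal (f (psum_pos Y k \<omega> + cusum Y (n - k) \<omega>')) \<partial>M \<partial>M)"
    unfolding psum_pos_def
    by (rule Spitzer_recursion[where f = "\<lambda>x. ennreal (f x)",
          OF borel_measurable_psum_iid borel_measurable_cusum_iid Y1 psum0 cusum0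
            nn_integral_psum_Suc[OF iid] nn_integral_cusum_Suc[OF iid]]) auto
  also have "\<dots> = (\<Sum>k=1..n. \<integral>\<^sup>+z. ennreal (F k z) \<partial>(M \<Otimes>\<^sub>M M))"
    by (simp only: iterated[symmetric]) (simp add: F_def)
  finally have rec: "of_nat n * (\<integral>\<^sup>+\<omega>. ennreal (f (cusum Y n \<omega>)) \<partial>M) = \<dots>" .
  have lhs: "(\<integral>\<^sup>+\<omega>. ennreal (f (cusum Y n \<omega>)) \<partial>M) = ennreal (\<integral>\<omega>. f (cusum Y n \<omega>) \<partial>M)"
    using int by (rule nn_integral_eq_integral) (simp add: nonneg cusum_nonneg)
  \<comment> \<open>Each term is nonnegative and hence at most the whole sum, which is the finite
    left-hand side.\<close>
  have F_int: "integrable (M \<Otimes>\<^sub>M M) (F k)" if "k \<in> {1..n}" for k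
  proof (rule integrableI_nonneg)
    have "(\<integral>\<^sup>+z. ennreal (F k z) \<partial>(M \<Otimes>\<^sub>M M)) \<le> (\<Sum>k=1..n. \<integral>\<^sup>+z. ennreal (F k z) \<partial>(M \<Otimes>\<^sub>M M))"
      using that by (intro member_le_sum) auto
    also have "\<dots> < \<infinity>"
      unfolding rec[symmetric] lhs by (simp add: ennreal_mult_less_top of_nat_less_top)
    finally show "(\<integral>\<^sup>+z. ennreal (F k z) \<partial>(M \<Otimes>\<^sub>M M)) < \<infinity>" .
  qed (simp_all add: F_nonneg)
  have "ennreal (real n * (\<integral>\<omega>. f (cusum Y n \<omega>) \<partial>M)) = (\<Sum>k=1..n. \<integral>\<^sup>+z. ennreal (F k z) \<partial>(M \<Otimes>\<^sub>M M))"
    using rec lhs by (simp add: ennreal_mult' ennreal_of_nat_eq_real_of_nat)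
  also have "\<dots> = (\<Sum>k=1..n. ennreal (\<integral>z. F k z \<partial>(M \<Otimes>\<^sub>M M)))"
    by (intro sum.cong nn_integral_eq_integral F_int) (simp_all add: F_nonneg)
  also have "\<dots> = ennreal (\<Sum>k=1..n. \<integral>z. F k z \<partial>(M \<Otimes>\<^sub>M M))"
    by (intro sum_ennreal Bochner_Integration.integral_nonneg F_nonneg)
  finally have "real n * (\<integral>\<omega>. f (cusum Y n \<omega>) \<partial>M) = (\<Sum>k=1..n. \<integral>z. F k z \<partial>(M \<Otimes>\<^sub>M M))"
    by (subst (asm) ennreal_inj)
      (auto intro!: mult_nonneg_nonneg sum_nonneg Bochner_Integration.integral_nonneg F_nonneg nonneg cusum_nonneg)
  also have "\<dots> = (\<Sum>k=1..n. \<integral>\<omega>. \<integral>\<omega>'. F k (\<omega>, \<omega>') \<partial>M \<partial>M)"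
    by (intro sum.cong refl P.integral_fst'[symmetric] F_int)
  finally show ?eq by (simp add: F_def)
  \<comment> \<open>Almost every section of the integrable \<open>F k\<close> is integrable; a
    probability space has a point where this holds, and \<open>c\<close> is read off there.\<close>
  have ex: "\<exists>\<omega>. P \<omega>" if "AE \<omega> in M. P \<omega>" for P
    using eventually_happens'[OF ae_filter_bot that] .
  assume k: "k \<in> {1..n}"
  have Fk: "integrable (M \<Otimes>\<^sub>M M) (\<lambda>(\<omega>, \<omega>'). F k (\<omega>, \<omega>'))"
    using F_int[OF k] by simp
  obtain \<omega>' where "integrable M (\<lambda>\<omega>. F k (\<omega>, \<omega>'))"
    using ex[OF P.AE_integrable_snd[OF Fk]] by blast
  then show ?S
    unfolding F_def prod.case using cusum_nonneg[of Y "n - k" \<omega>'] by blast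
  obtain \<omega> where "integrable M (\<lambda>\<omega>'. F k (\<omega>, \<omega>'))"
    using ex[OF P.AE_integrable_fst[OF Fk]] by blast
  then have "integrable M (\<lambda>\<omega>'. f (cusum Y (n - k) \<omega>' + psum_pos Y k \<omega>))"
    unfolding F_def prod.case by (simp only: add.commute)
  then show ?W using psum_pos_nonneg[of Y k \<omega>] by blast
qed


lemma integrable_cusum_parts:
  assumes int: "integrable M (cusum Y n)"
  shows "k \<in> {1..n} \<Longrightarrow> integrable M (psum_pos Y k)" and "m \<le> n \<Longrightarrow> integrable M (cusum Y m)"
proof -
  have shift: "integrable M X" if "integrable M (\<lambda>\<omega>. X \<omega> + c)" for X and c :: real
    using Bochner_Integration.integrable_diff[OF that, of "\<lambda>_. c"] by simp
  note Spitzer = cusum_Spitzer[of "\<lambda>x. x" n, OF _ _ int]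
  show "integrable M (psum_pos Y k)" if k: "k \<in> {1..n}"
  proof -
    obtain c where "integrable M (\<lambda>\<omega>. psum_pos Y k \<omega> + c)"
      using Spitzer(2)[OF _ _ k] by auto
    then show ?thesis by (rule shift)
  qed
  show "integrable M (cusum Y m)" if "m \<le> n"
  \<comment> \<open>For \<open>m < n\<close> the recursion is used at \<open>k = n - m\<close>; the
    index \<open>k = 0\<close> does not occur in it, so \<open>m = n\<close> is separate.\<close>
  proof (cases "m = n")
    case False
    with that have "n - m \<in> {1..n}" "n - (n - m) = m" by auto
    with Spitzer(3)[of "n - m"] obtain c where "integrable M (\<lambda>\<omega>. cusum Y m \<omega> + c)"
      by auto
    then show ?thesis by (rule shift)
  qed (simp add: int)
qed

lemma expectation_cusum_recursion:
  assumes int: "integrable M (cusum Y n)"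
  shows "real n * expectation (cusum Y n) =
    (\<Sum>k=1..n. expectation (psum_pos Y k) + expectation (cusum Y (n - k)))"
proof -
  have "real n * expectation (cusum Y n) =
      (\<Sum>k=1..n. \<integral>\<omega>. \<integral>\<omega>'. psum_pos Y k \<omega> + cusum Y (n - k) \<omega>' \<partial>M \<partial>M)"
    using cusum_Spitzer(1)[of "\<lambda>x. x" n] int by simp
  also have "\<dots> = (\<Sum>k=1..n. expectation (psum_pos Y k) + expectation (cusum Y (n - k)))"
    using integrable_cusum_parts[OF int] by (intro sum.cong) (simp_all add: prob_space)
  finally show ?thesis .
qed

lemma square_integrable_cusum_parts:
  assumes int2: "integrable M (\<lambda>\<omega>. (cusum Y n \<omega>)\<^sup>2)"
  shows "k \<in> {1..n} \<Longrightarrow> integrable M (\<lambda>\<omega>. (psum_pos Y k \<omega>)\<^sup>2)"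
    and "m \<le> n \<Longrightarrow> integrable M (\<lambda>\<omega>. (cusum Y m \<omega>)\<^sup>2)"
proof -
  note Spitzer = cusum_Spitzer[of "\<lambda>x. x\<^sup>2" n, OF _ _ int2]
  show "integrable M (\<lambda>\<omega>. (psum_pos Y k \<omega>)\<^sup>2)" if k: "k \<in> {1..n}"
  proof -
    obtain c where "0 \<le> c" "integrable M (\<lambda>\<omega>. (psum_pos Y k \<omega> + c)\<^sup>2)"
      using Spitzer(2)[OF _ _ k] by auto
    with psum_pos_nonneg show ?thesis
      by (rule square_integrable_if_shift_square_integrable[OF borel_measurable_psum_pos_iid])
  qed
  show "integrable M (\<lambda>\<omega>. (cusum Y m \<omega>)\<^sup>2)" if "m \<le> n"
  proof (cases "m = n")
    case False
    with that have "n - m \<in> {1..n}" "n - (n - m) = m" by auto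
    with Spitzer(3)[of "n - m"] obtain c where "0 \<le> c" "integrable M (\<lambda>\<omega>. (cusum Y m \<omega> + c)\<^sup>2)"
      by auto
    with cusum_nonneg show ?thesis
      by (rule square_integrable_if_shift_square_integrable[OF borel_measurable_cusum_iid])
  qed (simp add: int2)
qed

lemma second_moment_cusum_recursion:
  assumes int: "integrable M (cusum Y n)" and int2: "integrable M (\<lambda>\<omega>. (cusum Y n \<omega>)\<^sup>2)"
  shows "real n * expectation (\<lambda>\<omega>. (cusum Y n \<omega>)\<^sup>2) =
    (\<Sum>k=1..n. expectation (\<lambda>\<omega>. (psum_pos Y k \<omega>)\<^sup>2)
      + 2 * expectation (psum_pos Y k) * expectation (cusum Y (n - k))
      + expectation (\<lambda>\<omega>. (cusum Y (n - k) \<omega>)\<^sup>2))"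
proof -
  have "real n * expectation (\<lambda>\<omega>. (cusum Y n \<omega>)\<^sup>2) =
      (\<Sum>k=1..n. \<integral>\<omega>. \<integral>\<omega>'. (psum_pos Y k \<omega> + cusum Y (n - k) \<omega>')\<^sup>2 \<partial>M \<partial>M)"
    using cusum_Spitzer(1)[of "\<lambda>x. x\<^sup>2" n] int2 by simp
  also have "\<dots> = (\<Sum>k=1..n. expectation (\<lambda>\<omega>. (psum_pos Y k \<omega>)\<^sup>2)
      + 2 * expectation (psum_pos Y k) * expectation (cusum Y (n - k))
      + expectation (\<lambda>\<omega>. (cusum Y (n - k) \<omega>)\<^sup>2))"
    using integrable_cusum_parts[OF int] square_integrable_cusum_parts[OF int2]
    by (intro sum.cong) (simp_all add: prob_space power2_sum)
  finally show ?thesis .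
qed

text \<open>A shift by \<open>c\<close> only multiplies the exponential by the nonzero constant
  \<open>exp (lam * c)\<close>, whatever the sign of \<open>lam\<close>.\<close>

lemma exp_integrable_cusum_parts:
  assumes int: "integrable M (\<lambda>\<omega>. exp (lam * cusum Y n \<omega>))"
  shows "k \<in> {1..n} \<Longrightarrow> integrable M (\<lambda>\<omega>. exp (lam * psum_pos Y k \<omega>))"
    and "m \<le> n \<Longrightarrow> integrable M (\<lambda>\<omega>. exp (lam * cusum Y m \<omega>))"
proof -
  note Spitzer = cusum_Spitzer[of "\<lambda>x. exp (lam * x)" n, simplified, OF int]
  show "k \<in> {1..n} \<Longrightarrow> integrable M (\<lambda>\<omega>. exp (lam * psum_pos Y k \<omega>))"
    using Spitzer(2)[of k] by (auto simp: distrib_left exp_add)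
  show "integrable M (\<lambda>\<omega>. exp (lam * cusum Y m \<omega>))" if "m \<le> n"
  proof (cases "m = n")
    case False
    then show ?thesis
      using Spitzer(3)[of "n - m"] that by (auto simp: distrib_left exp_add)
  qed (simp add: int)
qed

lemma mgf_cusum_recursion:
  assumes int: "integrable M (\<lambda>\<omega>. exp (lam * cusum Y n \<omega>))"
  shows "real n * expectation (\<lambda>\<omega>. exp (lam * cusum Y n \<omega>)) =
    (\<Sum>k=1..n. expectation (\<lambda>\<omega>. exp (lam * psum_pos Y k \<omega>)) *
      expectation (\<lambda>\<omega>. exp (lam * cusum Y (n - k) \<omega>)))"
  using cusum_Spitzer(1)[of "\<lambda>x. exp (lam * x)" n] int
  by (simp add: distrib_left exp_add)

section \<open>The three formulas\<close>

lemma expectation_cusum: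
  assumes int: "integrable M (cusum Y n)"
  shows "expectation (cusum Y n) = (\<Sum>k=1..n. expectation (psum_pos Y k) / real k)"
proof (rule first_moment_recursion_solution[where n = n])
  show "real m * expectation (cusum Y m) =
      (\<Sum>k=1..m. expectation (psum_pos Y k) + expectation (cusum Y (m - k)))" if "m \<le> n" for m
    using integrable_cusum_parts(2)[OF int that] by (rule expectation_cusum_recursion)
qed auto

text \<open>The convolutions in the second moment cancel the pairs with k1 + k2 \<le> n in the
  squared mean. The second moment of each \<open>psum_pos Y k\<close> then splits into variance and
  squared mean.\<close>

lemma variance_cusum:
  assumes fv: "finite_variance M (cusum Y n)"
  shows "variance (cusum Y n) =
    (\<Sum>k=1..n. 1 / real k * variance (psum_pos Y k))
    + (\<Sum>k=1..n. 1 / real k * (expectation (psum_pos Y k))\<^sup>2)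
    - (\<Sum>(k1, k2)\<in>{(k1, k2). k1 \<in> {1..n} \<and> k2 \<in> {1..n} \<and> k1 + k2 > n}.
         1 / (real k1 * real k2) * expectation (psum_pos Y k1) * expectation (psum_pos Y k2))"
proof -
  define d where "d k = expectation (psum_pos Y k) / real k" for k
  have int: "integrable M (cusum Y n)" and int2: "integrable M (\<lambda>\<omega>. (cusum Y n \<omega>)\<^sup>2)"
    using fv by (simp_all add: finite_variance_iff_square_integrable)
  have second: "expectation (\<lambda>\<omega>. (cusum Y n \<omega>)\<^sup>2) =
      (\<Sum>k=1..n. expectation (\<lambda>\<omega>. (psum_pos Y k \<omega>)\<^sup>2) / real k)
      + (\<Sum>s=1..n. \<Sum>k=1..s-1. d k * d (s - k))"
    unfolding d_def
    by (rule second_moment_recursion_solution[where n = n and \<mu> = "\<lambda>m. expectation (cusum Y m)"])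
      (simp_all add: cusum_0 expectation_cusum_recursion second_moment_cusum_recursion
        integrable_cusum_parts[OF int] square_integrable_cusum_parts[OF int2])
  have "variance (cusum Y n) = expectation (\<lambda>\<omega>. (cusum Y n \<omega>)\<^sup>2) - (\<Sum>k=1..n. d k)\<^sup>2"
    using variance_eq[OF int int2] by (simp add: expectation_cusum[OF int] d_def)
  also have "\<dots> = (\<Sum>k=1..n. expectation (\<lambda>\<omega>. (psum_pos Y k \<omega>)\<^sup>2) / real k)
      - (\<Sum>(k1, k2)\<in>{(k1, k2). k1 \<in> {1..n} \<and> k2 \<in> {1..n} \<and> k1 + k2 > n}. d k1 * d k2)"
    unfolding second square_sum_minus_convolutions[symmetric] by simp
  also have "(\<Sum>k=1..n. expectation (\<lambda>\<omega>. (psum_pos Y k \<omega>)\<^sup>2) / real k) =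
      (\<Sum>k=1..n. 1 / real k * variance (psum_pos Y k))
      + (\<Sum>k=1..n. 1 / real k * (expectation (psum_pos Y k))\<^sup>2)"
    unfolding sum.distrib[symmetric]
  proof (rule sum.cong[OF refl])
    fix k assume "k \<in> {1..n}"
    then show "expectation (\<lambda>\<omega>. (psum_pos Y k \<omega>)\<^sup>2) / real k =
        1 / real k * variance (psum_pos Y k) + 1 / real k * (expectation (psum_pos Y k))\<^sup>2"
      using variance_eq[OF integrable_cusum_parts(1)[OF int] square_integrable_cusum_parts(1)[OF int2]]
      by (simp add: diff_divide_distrib)
  qed
  finally show ?thesis by (simp add: d_def)
qed

text \<open>Both sides start at 1 and obey the same recursion, which determines them up to index
  \<open>n\<close>; the tuple length stays \<open>n\<close> throughout.\<close>

lemma mgf_cusum: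
  assumes int: "integrable M (\<lambda>\<omega>. exp (lam * cusum Y n \<omega>))" and "m \<le> n"
  shows "expectation (\<lambda>\<omega>. exp (lam * cusum Y m \<omega>)) =
    cycle_index n (\<lambda>r. expectation (\<lambda>\<omega>. exp (lam * psum_pos Y r \<omega>))) m" (is "?\<phi> m = ?c m")
  using \<open>m \<le> n\<close>
proof (induction m rule: less_induct)
  case (less m)
  show ?case
  proof (cases "m = 0")
    case True
    then show ?thesis by (simp add: cycle_index_0 prob_space)
  next
    case False
    have "real m * ?\<phi> m = (\<Sum>k=1..m. expectation (\<lambda>\<omega>. exp (lam * psum_pos Y k \<omega>)) * ?\<phi> (m - k))"
      using exp_integrable_cusum_parts(2)[OF int less.prems] by (rule mgf_cusum_recursion)
    also have "\<dots> = (\<Sum>k=1..m. expectation (\<lambda>\<omega>. exp (lam * psum_pos Y k \<omega>)) * ?c (m - k))"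
      using less by (intro sum.cong) auto
    also have "\<dots> = real m * ?c m"
      by (rule cycle_index_rec[OF less.prems, symmetric])
    finally show ?thesis using False by simp
  qed
qed

end
end

theorem theorem2p1:
  fixes M :: "'a measure" and Y :: "nat \<Rightarrow> 'a \<Rightarrow> real" and n :: nat and lam :: real
  assumes "prob_space M"
    and "iid_sequence M Y"
    and "n \<ge> 1"
  shows
    "(integrable M (cusum Y n) \<longrightarrow>
        (\<forall>k\<in>{1..n}. integrable M (psum_pos Y k)) \<and>
        prob_space.expectation M (cusum Y n) =
          (\<Sum>k=1..n. 1 / real k * prob_space.expectation M (psum_pos Y k)))
   \<and> (finite_variance M (cusum Y n) \<longrightarrow>
        (\<forall>k\<in>{1..n}. finite_variance M (psum_pos Y k)) \<and>
        prob_space.variance M (cusum Y n) =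
          (\<Sum>k=1..n. 1 / real k * prob_space.variance M (psum_pos Y k))
          + (\<Sum>k=1..n. 1 / real k * (prob_space.expectation M (psum_pos Y k))\<^sup>2)
          - (\<Sum>(k1, k2)\<in>{(k1, k2). k1 \<in> {1..n} \<and> k2 \<in> {1..n} \<and> k1 + k2 > n}.
               1 / (real k1 * real k2) *
               prob_space.expectation M (psum_pos Y k1) *
               prob_space.expectation M (psum_pos Y k2)))
   \<and> (integrable M (\<lambda>\<omega>. exp (lam * cusum Y n \<omega>)) \<longrightarrow>
        (\<forall>r\<in>{1..n}. integrable M (\<lambda>\<omega>. exp (lam * psum_pos Y r \<omega>))) \<and>
        prob_space.expectation M (\<lambda>\<omega>. exp (lam * cusum Y n \<omega>)) =
          (\<Sum>k\<in>weighted_tuples n. \<Prod>r=1..n.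
             (prob_space.expectation M (\<lambda>\<omega>. exp (lam * psum_pos Y r \<omega>))) ^ k r
             / (real r ^ k r * fact (k r))))"
proof -
  interpret prob_space M by fact
  note iid = \<open>iid_sequence M Y\<close>
  have "finite_variance M (cusum Y n) \<Longrightarrow> k \<in> {1..n} \<Longrightarrow> finite_variance M (psum_pos Y k)" for k
    unfolding finite_variance_iff_square_integrable[OF borel_measurable_cusum_iid[OF iid]]
      finite_variance_iff_square_integrable[OF borel_measurable_psum_pos_iid[OF iid]]
    using integrable_cusum_parts(1)[OF iid] square_integrable_cusum_parts(1)[OF iid] by blast
  moreover have "expectation (\<lambda>\<omega>. exp (lam * cusum Y n \<omega>)) =
      (\<Sum>k\<in>weighted_tuples n. \<Prod>r=1..n.
         (expectation (\<lambda>\<omega>. exp (lam * psum_pos Y r \<omega>))) ^ k r / (real r ^ k r * fact (k r)))"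
    if "integrable M (\<lambda>\<omega>. exp (lam * cusum Y n \<omega>))"
    \<comment> \<open>At weight \<open>n\<close> the index set of \<open>cycle_index n\<close> is
      literally \<open>weighted_tuples n\<close>.\<close>
    using mgf_cusum[OF iid that order_refl] unfolding cycle_index_def weighted_tuples_def .
  ultimately show ?thesis
    using integrable_cusum_parts(1)[OF iid] expectation_cusum[OF iid] variance_cusum[OF iid]
      exp_integrable_cusum_parts(1)[OF iid]
    by (intro conjI impI ballI) simp_all
qed

end
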